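(* Let $X$ be an invertible complex square matrix. The higher differentials $d^n\|X\|_1$, with $n\ge 3$, can be computed iteratively by solving the equation $d^n(|X|\,|X|)=d^n(X^\dagger X)=0$ for the differentials $d^n\,\mathrm{vec}|X|$. Each such equation takes the form $$\left(d^n|X|\right)|X|+|X|\,d^n|X|=C_n,$$ where $C_n$ only contains differentials of order less than $n$. Each equation can be solved as $$d^n\,\mathrm{vec}|X|=\left(|X|_\oplus\right)^{-1}\mathrm{vec}\,C_n,$$ and, in terms of lower-order differentials of $|X|$, $$d^n\|X\|_1=\frac12\,\mathrm{Tr}\left(|X|^{-1}C_n\right).$$
   Context: $X$ is an unpatterned square matrix of complex variables (its entries are independent variables), assumed invertible so that the trace norm is differentiable. The integer $n$ is the order of the differential, not the size of the matrix. $X^\dagger$ is the conjugate transpose, $|X|=\sqrt{X^\dagger X}$, and $\|X\|_1=\mathrm{Tr}|X|$ is the trace norm. $\mathrm{vec}\,Y$ stacks the columns of a matrix $Y$ into a column vector. For a square matrix $Y$, $Y_\oplus:=Y^T\otimes I+I\otimes Y$, where $\otimes$ is the Kronecker product and $I$ is the identity matrix of the same size as $Y$; $|X|_\oplus$ is invertible when $X$ is. $d$ denotes the differential and $d^n$ its $n$-fold iterate; second and higher differentials of the variables $X$ and $X^\dagger$ themselves are zero by definition, and $d$ commutes with trace and vec. $C_n$ denotes the matrix that results from moving all terms of the expansion of $d^n(|X|\,|X|)=0$ other than $(d^n|X|)|X|$ and $|X|\,d^n|X|$ to the right-hand side. *)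

theory Defs
  imports "HOL-Analysis.Analysis"
begin

section \<open>Iterated differentials\<close>

text \<open>
  The differential of order \<open>n\<close> at \<open>X\<close> for a constant increment \<open>H\<close> (that is, \<open>H\<close> plays the role
  of the differential of the variable).  Since \<open>H\<close> does not vary with \<open>X\<close>, the second and higher
  differentials of the variable vanish.  On complex matrices the Frechet derivative is the
  real-linear one, so the conjugate variable has the conjugate of \<open>H\<close> as its differential.
\<close>

primrec ndiff ::
    "nat \<Rightarrow> ('a::real_normed_vector \<Rightarrow> 'b::real_normed_vector) \<Rightarrow> 'a \<Rightarrow> 'a \<Rightarrow> 'b" where
  "ndiff 0 f H = f"
| "ndiff (Suc n) f H = (\<lambda>X. frechet_derivative (ndiff n f H) (at X) H)"


section \<open>Matrix absolute value and trace norm\<close>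

definition cadjoint :: "complex^'n^'m \<Rightarrow> complex^'m^'n" where
  "cadjoint A = (\<chi> i j. cnj (A $ j $ i))"

definition pos_semidef :: "complex^'n^'n \<Rightarrow> bool" where
  "pos_semidef A \<longleftrightarrow>
     cadjoint A = A \<and> (\<forall>v. 0 \<le> Re (\<Sum>i\<in>UNIV. cnj (v $ i) * (A *v v) $ i))"

definition matrix_sqrt :: "complex^'n^'n \<Rightarrow> complex^'n^'n" where
  "matrix_sqrt A = (THE B. pos_semidef B \<and> B ** B = A)"

definition matrix_abs :: "complex^'n^'n \<Rightarrow> complex^'n^'n" where
  "matrix_abs X = matrix_sqrt (cadjoint X ** X)"

text \<open>
  The trace of the positive semidefinite matrix \<open>matrix_abs X\<close> is real; \<open>Re\<close> only changes its type.
\<close>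

definition trace_norm :: "complex^'n^'n \<Rightarrow> real" where
  "trace_norm X = Re (trace (matrix_abs X))"


section \<open>Vectorization and Kronecker products\<close>

text \<open>
  Column stacking: the entry in row \<open>i\<close> and column \<open>j\<close> gets the index \<open>(j, i)\<close>, so that the
  lexicographic order on index pairs lists the columns one after the other.  Index pairs of
  Kronecker products are ordered in the same way: the first component belongs to the first factor.
\<close>

definition mvec :: "'a^'n^'m \<Rightarrow> 'a^('n \<times> 'm)" where
  "mvec Y = (\<chi> p. Y $ snd p $ fst p)"

definition kronecker ::
    "'a::times^'n^'m \<Rightarrow> 'a^'q^'p \<Rightarrow> 'a^('n \<times> 'q)^('m \<times> 'p)" where
  "kronecker A B = (\<chi> r c. A $ fst r $ fst c * B $ snd r $ snd c)"

definition kronecker_sum :: "'a::semiring_1^'n^'n \<Rightarrow> 'a^('n \<times> 'n)^('n \<times> 'n)" where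
  "kronecker_sum Y = kronecker (transpose Y) (mat 1) + kronecker (mat 1) Y"


section \<open>Expansion of the differentials of a matrix square\<close>

text \<open>
  Here \<open>D k\<close> stands for the differential of order \<open>k\<close> of a matrix function \<open>A\<close>.  Then
  \<open>square_term n D k\<close>, for \<open>k = 0, \<dots>, n\<close>, are the terms of the Leibniz expansion of the
  differential of order \<open>n\<close> of \<open>A ** A\<close>.  The two terms containing \<open>D n\<close> are those for \<open>k = n\<close>,
  namely \<open>D n ** D 0\<close>, and for \<open>k = 0\<close>, namely \<open>D 0 ** D n\<close>; \<open>rhs_matrix n D\<close> collects all the
  others on the other side of the equation.
\<close>

definition square_term ::
    "nat \<Rightarrow> (nat \<Rightarrow> complex^'n^'n) \<Rightarrow> nat \<Rightarrow> complex^'n^'n" where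
  "square_term n D k = real (n choose k) *\<^sub>R (D k ** D (n - k))"

definition rhs_matrix :: "nat \<Rightarrow> (nat \<Rightarrow> complex^'n^'n) \<Rightarrow> complex^'n^'n" where
  "rhs_matrix n D = - (\<Sum>k\<in>{0..n} - {0, n}. square_term n D k)"

end

theory Submission
  imports Defs
begin

text \<open>
  A Hermitian \<open>A\<close> bounded below by \<open>c > 0\<close> makes the Sylvester operator \<open>Z \<mapsto> Z B + A Z\<close> coercive
  for every positive semidefinite \<open>B\<close> in the Frobenius inner product. This gives uniqueness of the
  square root, invertibility of the Kronecker sum of \<open>|X|\<close>, and a Lipschitz bound for \<open>|X|\<close>, from
  which the first derivative follows. Existence of the square root is a fixed point argument, so no
  spectral theorem is involved. Smoothness is then an induction: by the Leibniz rule the differential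
  of order \<open>k\<close> of \<open>|X|\<close> solves a Sylvester equation whose right-hand side contains lower orders only,
  and by Cramer's rule the solution depends differentiably on the data.
\<close>

section \<open>Calculus of iterated differentials\<close>

lemma ndiff_Suc_eq:
  "(ndiff k f H has_derivative f') (at x) \<Longrightarrow> ndiff (Suc k) f H x = f' H"
  by (simp add: frechet_derivative_at [symmetric])

lemma has_derivative_cong_open:
  assumes "open S" "x \<in> S" "\<And>y. y \<in> S \<Longrightarrow> f y = g y"
  shows "(f has_derivative f') (at x) \<longleftrightarrow> (g has_derivative f') (at x)"
  using has_derivative_transform_within_open [of f f' x UNIV S g]
    has_derivative_transform_within_open [of g f' x UNIV S f] assms by auto

lemma differentiable_cong_open:
  assumes "open S" "x \<in> S" "\<And>y. y \<in> S \<Longrightarrow> f y = g y"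
  shows "f differentiable (at x) \<longleftrightarrow> g differentiable (at x)"
  unfolding differentiable_def using has_derivative_cong_open [OF assms] by simp

text \<open>Differentials of all orders are local, so identities for \<open>matrix_abs\<close> on
  the open set of invertible matrices can be differentiated repeatedly.\<close>

lemma ndiff_cong_open:
  assumes "open S" "x \<in> S" "\<And>y. y \<in> S \<Longrightarrow> f y = g y"
  shows "ndiff k f H x = ndiff k g H x"
  using assms(2)
proof (induction k arbitrary: x)
  case 0
  then show ?case using assms(3) by simp
next
  case (Suc k)
  \<comment> \<open>No differentiability is assumed: \<open>frechet_derivative\<close> chooses from
    the set of derivatives, and that set is the same for both functions.\<close>
  have "frechet_derivative (ndiff k f H) (at x) = frechet_derivative (ndiff k g H) (at x)"
    unfolding frechet_derivative_def
    using has_derivative_cong_open [OF assms(1) Suc.prems Suc.IH] by simp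
  then show ?case by simp
qed

text \<open>This lets d commute with vec, trace and adjoint. Smoothness is asked on all of
  \<open>S\<close>, since the induction differentiates an identity that must hold near
  \<open>x\<close>.\<close>

lemma ndiff_bounded_linear:
  assumes L: "bounded_linear L" and "open S" and "x \<in> S"
    and f: "\<And>j x. j < k \<Longrightarrow> x \<in> S \<Longrightarrow> ndiff j f H differentiable (at x)"
  shows "ndiff k (\<lambda>x. L (f x)) H x = L (ndiff k f H x)"
  using \<open>x \<in> S\<close> f
proof (induction k arbitrary: x)
  case 0
  then show ?case by simp
next
  case (Suc k)
  have "(ndiff k f H has_derivative frechet_derivative (ndiff k f H) (at x)) (at x)"
    using Suc.prems by (simp add: frechet_derivative_works [symmetric])
  from bounded_linear.has_derivative [OF L this]
  have "((\<lambda>x. L (ndiff k f H x)) has_derivative (\<lambda>h. L (frechet_derivative (ndiff k f H) (at x) h))) (at x)" .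
  then have "(ndiff k (\<lambda>x. L (f x)) H has_derivative (\<lambda>h. L (frechet_derivative (ndiff k f H) (at x) h))) (at x)"
    by (rule has_derivative_cong_open [THEN iffD2, OF assms(2) Suc.prems(1), rotated])
      (simp add: Suc.IH Suc.prems(2))
  from ndiff_Suc_eq [OF this] show ?case by simp
qed

text \<open>Pascal's rule; \<open>T i j\<close> stands for the product of a differential of order
  \<open>i\<close> with one of order \<open>j\<close>.\<close>

lemma sum_binomial_Suc:
  fixes T :: "nat \<Rightarrow> nat \<Rightarrow> 'a::real_vector"
  shows "(\<Sum>j\<le>k. real (k choose j) *\<^sub>R (T (Suc j) (k - j) + T j (Suc k - j))) =
    (\<Sum>j\<le>Suc k. real (Suc k choose j) *\<^sub>R T j (Suc k - j))"
proof -
  \<comment> \<open>The extra summand vanishes because \<open>k choose Suc k\<close> is 0.\<close>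
  have "(\<Sum>j\<le>k. real (k choose j) *\<^sub>R T j (Suc k - j)) =
      (\<Sum>j\<le>Suc k. real (k choose j) *\<^sub>R T j (Suc k - j))"
    by simp
  also have "\<dots> = T 0 (Suc k) + (\<Sum>j\<le>k. real (k choose Suc j) *\<^sub>R T (Suc j) (k - j))"
    by (subst sum.atMost_Suc_shift) simp
  finally have "(\<Sum>j\<le>k. real (k choose j) *\<^sub>R T (Suc j) (k - j)) +
      (\<Sum>j\<le>k. real (k choose j) *\<^sub>R T j (Suc k - j)) =
      T 0 (Suc k) + (\<Sum>j\<le>k. real (Suc k choose Suc j) *\<^sub>R T (Suc j) (k - j))"
    by (simp add: sum.distrib scaleR_add_left)
  then show ?thesis
    by (subst sum.atMost_Suc_shift) (simp add: sum.distrib scaleR_add_right)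
qed

text \<open>General Leibniz rule. The order of the factors is preserved, so it applies to the
  noncommutative matrix product.\<close>

lemma ndiff_bounded_bilinear:
  assumes b: "bounded_bilinear b" and "open S" and "x \<in> S"
    and f: "\<And>j x. j < k \<Longrightarrow> x \<in> S \<Longrightarrow> ndiff j f H differentiable (at x)"
    and g: "\<And>j x. j < k \<Longrightarrow> x \<in> S \<Longrightarrow> ndiff j g H differentiable (at x)"
  shows "ndiff k (\<lambda>x. b (f x) (g x)) H x =
    (\<Sum>j\<le>k. real (k choose j) *\<^sub>R b (ndiff j f H x) (ndiff (k - j) g H x))"
  using \<open>x \<in> S\<close> f g
proof (induction k arbitrary: x)
  case 0
  then show ?case by simp
next
  case (Suc k)
  let ?f = "\<lambda>j. frechet_derivative (ndiff j f H) (at x)"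
  let ?g = "\<lambda>j. frechet_derivative (ndiff j g H) (at x)"
  let ?d = "\<lambda>h. \<Sum>j\<le>k. real (k choose j) *\<^sub>R
      (b (ndiff j f H x) (?g (k - j) h) + b (?f j h) (ndiff (k - j) g H x))"
  have "(ndiff j f H has_derivative ?f j) (at x)" "(ndiff (k - j) g H has_derivative ?g (k - j)) (at x)"
    if "j \<le> k" for j
    using Suc.prems that by (auto simp: frechet_derivative_works [symmetric])
  then have "((\<lambda>x. \<Sum>j\<le>k. real (k choose j) *\<^sub>R b (ndiff j f H x) (ndiff (k - j) g H x))
      has_derivative ?d) (at x)"
    by (intro has_derivative_sum has_derivative_scaleR_right bounded_bilinear.FDERIV [OF b]) auto
  then have "(ndiff k (\<lambda>x. b (f x) (g x)) H has_derivative ?d) (at x)"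
    by (rule has_derivative_cong_open [THEN iffD2, OF assms(2) Suc.prems(1), rotated])
      (simp add: Suc.IH Suc.prems(2,3))
  from ndiff_Suc_eq [OF this] have "ndiff (Suc k) (\<lambda>x. b (f x) (g x)) H x =
     (\<Sum>j\<le>k. real (k choose j) *\<^sub>R
      (b (ndiff (Suc j) f H x) (ndiff (k - j) g H x) + b (ndiff j f H x) (ndiff (Suc k - j) g H x)))"
    by (simp add: add.commute Suc_diff_le)
  also have "\<dots> = (\<Sum>j\<le>Suc k. real (Suc k choose j) *\<^sub>R b (ndiff j f H x) (ndiff (Suc k - j) g H x))"
    by (rule sum_binomial_Suc [where T = "\<lambda>i j. b (ndiff i f H x) (ndiff j g H x)"])
  finally show ?case .
qed

text \<open>The convention that second and higher differentials of the variable vanish becomes a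
  fact, because the increment \<open>H\<close> is constant.\<close>

lemma ndiff_id: "ndiff 0 (\<lambda>x. x) H x = x" "ndiff (Suc 0) (\<lambda>x. x) H x = H"
  "ndiff (Suc (Suc k)) (\<lambda>x. x) H x = 0"
proof -
  have 1: "ndiff (Suc 0) (\<lambda>x. x) H = (\<lambda>_. H)"
    by (rule ext, rule ndiff_Suc_eq) (simp add: has_derivative_ident)
  have "ndiff (Suc (Suc k)) (\<lambda>x. x) H = (\<lambda>_. 0)" for k
  proof (induction k)
    case 0
    show ?case by (rule ext, rule ndiff_Suc_eq) (simp add: 1 del: ndiff.simps)
  next
    case (Suc k)
    show ?case by (rule ext, rule ndiff_Suc_eq) (simp add: Suc del: ndiff.simps)
  qed
  with 1 show "ndiff 0 (\<lambda>x. x) H x = x" "ndiff (Suc 0) (\<lambda>x. x) H x = H"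
    "ndiff (Suc (Suc k)) (\<lambda>x. x) H x = 0" by (simp_all del: ndiff.simps(2))
qed

lemma ndiff_id_differentiable: "ndiff k (\<lambda>x. x) H differentiable (at x)"
proof -
  consider "k = 0" | "k = Suc 0" | j where "k = Suc (Suc j)"
    by (metis not0_implies_Suc)
  then have "ndiff k (\<lambda>x. x) H = (\<lambda>x. x) \<or> (\<exists>c. ndiff k (\<lambda>x. x) H = (\<lambda>_. c))"
    by cases (auto simp: fun_eq_iff ndiff_id simp del: ndiff.simps(2))
  then show ?thesis by auto
qed

lemma differentiable_bounded_linear:
  "bounded_linear L \<Longrightarrow> f differentiable (at x) \<Longrightarrow> (\<lambda>x. L (f x)) differentiable (at x)"
  unfolding differentiable_def using bounded_linear.has_derivative by blast

lemma ndiff_bounded_linear_differentiable: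
  assumes "bounded_linear L" "open S" "x \<in> S"
    and f: "\<And>j x. x \<in> S \<Longrightarrow> ndiff j f H differentiable (at x)"
  shows "ndiff k (\<lambda>x. L (f x)) H differentiable (at x)"
proof -
  have "(\<lambda>x. L (ndiff k f H x)) differentiable (at x)"
    by (rule differentiable_bounded_linear [OF assms(1) f [OF assms(3)]])
  then show ?thesis
    by (rule differentiable_cong_open [THEN iffD2, OF assms(2,3), rotated])
      (rule ndiff_bounded_linear [OF assms(1,2) _ f])
qed

section \<open>Differentiable dependence of solutions of linear systems\<close>

lemma differentiable_prod:
  fixes f :: "'i \<Rightarrow> 'a::real_normed_vector \<Rightarrow> 'b::real_normed_field"
  assumes "\<And>i. i \<in> I \<Longrightarrow> f i differentiable (at x)"
  shows "(\<lambda>x. \<Prod>i\<in>I. f i x) differentiable (at x)"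
proof (cases "finite I")
  case True
  then show ?thesis using assms by (induction I) auto
qed auto

lemma differentiable_det:
  fixes A :: "'a::real_normed_vector \<Rightarrow> 'b::real_normed_field^'n^'n"
  assumes "\<And>i j. (\<lambda>x. A x $ i $ j) differentiable (at x)"
  shows "(\<lambda>x. det (A x)) differentiable (at x)"
  unfolding det_def
proof (rule differentiable_sum [OF finite_permutations [OF finite]], intro ballI, rule differentiable_mult)
  fix p :: "'n \<Rightarrow> 'n"
  show "(\<lambda>x. \<Prod>i\<in>UNIV. A x $ i $ p i) differentiable (at x)"
    by (rule differentiable_prod) (rule assms)
qed (rule differentiable_const)

lemma differentiable_vecI:
  fixes f :: "'a::real_normed_vector \<Rightarrow> 'b::euclidean_space^'n"
  assumes "\<And>i. (\<lambda>x. f x $ i) differentiable (at x)"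
  shows "f differentiable (at x)"
proof (subst differentiable_componentwise_within, intro ballI)
  fix b :: "'b^'n" assume "b \<in> Basis"
  have "(\<lambda>x. \<Sum>i\<in>UNIV. f x $ i \<bullet> b $ i) differentiable (at x)"
    using assms by (intro differentiable_sum differentiable_inner) auto
  then show "(\<lambda>x. f x \<bullet> b) differentiable (at x)" by (simp add: inner_vec_def)
qed

lemma differentiable_nth:
  fixes f :: "'a::real_normed_vector \<Rightarrow> 'b::real_normed_vector^'n"
  shows "f differentiable (at x) \<Longrightarrow> (\<lambda>x. f x $ i) differentiable (at x)"
  by (rule differentiable_bounded_linear [OF bounded_linear_vec_nth])

text \<open>Cramer's rule writes each coordinate of \<open>z\<close> near \<open>x\<close> as a
  quotient of determinants, which are polynomials in the differentiable data. Nothing is assumed of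
  \<open>z\<close> beyond the equation.\<close>

lemma differentiable_solution:
  fixes A :: "'a::real_normed_vector \<Rightarrow> 'b::{real_normed_field,euclidean_space}^'n^'n"
  assumes "open S" "x \<in> S" and "A differentiable (at x)" "c differentiable (at x)"
    and "invertible (A x)"
    and eq: "\<And>y. y \<in> S \<Longrightarrow> A y *v z y = c y"
  shows "z differentiable (at x)"
proof (rule differentiable_vecI)
  fix k
  let ?n = "\<lambda>y. det (\<chi> i j. if j = k then c y $ i else A y $ i $ j)"
  have A: "(\<lambda>y. A y $ i $ j) differentiable (at x)" for i j
    using assms(3) by (intro differentiable_nth)
  have det: "(\<lambda>y. det (A y)) differentiable (at x)"
    by (rule differentiable_det) (rule A)
  have det0: "det (A x) \<noteq> 0" using assms(5) by (simp add: invertible_det_nz)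
  have num: "?n differentiable (at x)"
  proof (rule differentiable_det)
    fix i j
    show "(\<lambda>y. (\<chi> i j. if j = k then c y $ i else A y $ i $ j) $ i $ j) differentiable (at x)"
      using A assms(4) by (cases "j = k") (auto intro: differentiable_nth)
  qed
  have quot: "(\<lambda>y. ?n y / det (A y)) differentiable (at x)"
    using num det det0 by (rule differentiable_divide)
  have "continuous (at x) (\<lambda>y. det (A y))"
    using det by (rule differentiable_imp_continuous_within)
  \<comment> \<open>Invertibility is assumed at \<open>x\<close> only; continuity of the determinant
    extends it to a ball.\<close>
  from continuous_at_avoid [OF this det0] obtain e
    where e: "e > 0" "\<And>y. dist x y < e \<Longrightarrow> det (A y) \<noteq> 0"
    by blast
  have "z y $ k = ?n y / det (A y)" if "y \<in> S \<inter> ball x e" for y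
  proof -
    have "?n y = z y $ k * det (A y)"
      using cramer_lemma [of k "A y" "z y"] eq [of y] that by (simp cong: if_cong)
    then show ?thesis using e(2) [of y] that by simp
  qed
  note eq_quot = this
  have "open (S \<inter> ball x e)" "x \<in> S \<inter> ball x e" using assms e by auto
  from iffD2 [OF differentiable_cong_open [OF this eq_quot] quot]
  show "(\<lambda>y. z y $ k) differentiable (at x)" .
qed

section \<open>Positive semidefinite matrices and the Sylvester equation\<close>

lemma cadjoint_nth [simp]: "cadjoint A $ i $ j = cnj (A $ j $ i)"
  by (simp add: cadjoint_def)

lemma cadjoint_cadjoint [simp]: "cadjoint (cadjoint A) = A"
  by (simp add: vec_eq_iff)

lemma cadjoint_matrix_mul: "cadjoint (A ** B) = cadjoint B ** cadjoint A"
  by (simp add: vec_eq_iff matrix_matrix_mult_def mult.commute)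

lemma bounded_linear_cadjoint: "bounded_linear cadjoint"
  by (simp add: linear_conv_bounded_linear [symmetric] linear_iff vec_eq_iff)

lemma bounded_bilinear_matrix_mul:
  "bounded_bilinear ((**) :: complex^'n^'m \<Rightarrow> complex^'p^'n \<Rightarrow> complex^'p^'m)"
  by (subst bilinear_conv_bounded_bilinear [symmetric])
    (simp add: bilinear_def linear_iff vec_eq_iff matrix_matrix_mult_def sum.distrib
      algebra_simps scaleR_sum_right)

lemma inner_complex_cnj: "Re (cnj a * b) = a \<bullet> b"
  by (simp add: inner_complex_def)

lemma pos_semidef_iff:
  "pos_semidef A \<longleftrightarrow> cadjoint A = A \<and> (\<forall>v. 0 \<le> v \<bullet> (A *v v))"
  by (simp add: pos_semidef_def inner_vec_def inner_complex_def)

text \<open>The real inner product on complex vectors is the real part of the Hermitian one, so the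
  conjugate transpose is also the adjoint for it.\<close>

lemma inner_cadjoint_vec: "x \<bullet> (A *v y) = (cadjoint A *v x) \<bullet> y"
proof -
  have "x \<bullet> (A *v y) = Re (\<Sum>i\<in>UNIV. \<Sum>j\<in>UNIV. cnj (x $ i) * (A $ i $ j * y $ j))"
    by (simp only: inner_vec_def inner_complex_cnj [symmetric] matrix_vector_mult_def
        sum_distrib_left Re_sum vec_lambda_beta)
  also have "\<dots> = Re (\<Sum>j\<in>UNIV. \<Sum>i\<in>UNIV. cnj (x $ i) * (A $ i $ j * y $ j))"
    by (subst sum.swap) (rule refl)
  also have "\<dots> = Re (\<Sum>j\<in>UNIV. cnj ((cadjoint A *v x) $ j) * y $ j)"
    by (simp only: matrix_vector_mult_def cnj_sum complex_cnj_mult cadjoint_nth complex_cnj_cnj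
        sum_distrib_left sum_distrib_right vec_lambda_beta mult_ac)
  also have "\<dots> = (cadjoint A *v x) \<bullet> y"
    by (simp only: inner_vec_def inner_complex_cnj [symmetric] Re_sum)
  finally show ?thesis .
qed

lemma inner_cadjoint: "cadjoint A \<bullet> cadjoint B = A \<bullet> B"
proof -
  have "cadjoint A \<bullet> cadjoint B = (\<Sum>i\<in>UNIV. \<Sum>j\<in>UNIV. A $ j $ i \<bullet> B $ j $ i)"
    by (simp add: inner_vec_def inner_complex_def)
  also have "\<dots> = A \<bullet> B"
    unfolding inner_vec_def by (rule sum.swap)
  finally show ?thesis .
qed

lemma inner_matrix_columns: "A \<bullet> B = (\<Sum>j\<in>UNIV. column j A \<bullet> column j B)"
  unfolding inner_vec_def column_def by (simp, rule sum.swap)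

lemma column_matrix_mul: "column j (A ** B) = A *v column j B"
  by (simp add: column_def matrix_matrix_mult_def matrix_vector_mult_def vec_eq_iff)

text \<open>Left multiplication acts on each column separately, and the Frobenius inner product is a
  sum over columns.\<close>

lemma inner_matrix_mul_ge:
  fixes A :: "complex^'n^'n" and E :: "complex^'m^'n"
  assumes "\<And>v. c * (v \<bullet> v) \<le> v \<bullet> (A *v v)"
  shows "c * (E \<bullet> E) \<le> E \<bullet> (A ** E)"
  unfolding inner_matrix_columns [of E] column_matrix_mul sum_distrib_left
  by (intro sum_mono assms)

lemma inner_Sylvester_ge:
  fixes A B E :: "complex^'n^'n"
  assumes A: "\<And>v. c * (v \<bullet> v) \<le> v \<bullet> (A *v v)" and B: "pos_semidef B"
  shows "c * (E \<bullet> E) \<le> E \<bullet> (E ** B + A ** E)"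
proof -
  \<comment> \<open>Taking adjoints turns right multiplication by the Hermitian \<open>B\<close>
    into left multiplication, where positivity of \<open>B\<close> can be used column by
    column.\<close>
  have "E \<bullet> (E ** B) = cadjoint E \<bullet> (B ** cadjoint E)"
    using B by (simp add: inner_cadjoint [of E, symmetric] cadjoint_matrix_mul pos_semidef_iff)
  moreover have "0 * (cadjoint E \<bullet> cadjoint E) \<le> cadjoint E \<bullet> (B ** cadjoint E)"
    using B by (intro inner_matrix_mul_ge) (simp add: pos_semidef_iff)
  moreover have "c * (E \<bullet> E) \<le> E \<bullet> (A ** E)"
    using A by (rule inner_matrix_mul_ge)
  ultimately show ?thesis by (simp add: inner_add_right)
qed

text \<open>Coercivity combined with Cauchy-Schwarz. The constant depends on \<open>A\<close> alone,
  so the bound is uniform when \<open>B\<close> varies with a neighbouring point.\<close>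

lemma norm_Sylvester_ge:
  fixes A B E :: "complex^'n^'n"
  assumes A: "\<And>v. c * (v \<bullet> v) \<le> v \<bullet> (A *v v)" and B: "pos_semidef B"
  shows "c * norm E \<le> norm (E ** B + A ** E)"
proof (cases "E = 0")
  case False
  have "c * (E \<bullet> E) \<le> E \<bullet> (E ** B + A ** E)"
    using assms by (rule inner_Sylvester_ge)
  also have "\<dots> \<le> norm E * norm (E ** B + A ** E)"
    by (rule norm_cauchy_schwarz)
  finally show ?thesis using False
    by (simp add: power2_norm_eq_inner [symmetric] power2_eq_square)
qed simp

section \<open>Existence of the square root\<close>

text \<open>The domain of the fixed point argument. Elements of the type are only real-linear;
  complex linearity is needed to return to a complex matrix, and symmetry to make it
  Hermitian.\<close>

lemma closed_symmetric_complex_blinfun: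
  "closed {Y :: (complex^'n) \<Rightarrow>\<^sub>L (complex^'n). norm Y \<le> r \<and>
     (\<forall>c v. blinfun_apply Y (c *s v) = c *s blinfun_apply Y v) \<and>
     (\<forall>v w. blinfun_apply Y v \<bullet> w = v \<bullet> blinfun_apply Y w)}"
proof -
  have "bounded_linear (\<lambda>v :: complex^'n. c *s v)" for c
    by (simp add: linear_conv_bounded_linear [symmetric] linear_iff vec_eq_iff algebra_simps)
  then have "continuous_on UNIV (\<lambda>Y :: (complex^'n) \<Rightarrow>\<^sub>L (complex^'n). c *s Y v)" for c v
    by (rule bounded_linear.continuous_on) (intro continuous_intros)
  then show ?thesis
    by (intro closed_Collect_conj closed_Collect_all closed_Collect_eq closed_Collect_le)
      (auto intro!: continuous_intros)
qed

text \<open>\<open>Y\<close> solves \<open>2 Y = T + Y\<^sup>2\<close>, that is, \<open>(1 - Y)\<^sup>2 = 1 - T\<close>; this is a contraction on the ball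
  of radius \<open>r < 1\<close>.\<close>

lemma contraction_sqrt:
  fixes T :: "(complex^'n) \<Rightarrow>\<^sub>L (complex^'n)"
  assumes r: "0 \<le> r" "r < 1" and T: "norm T \<le> r" "\<And>c v. T (c *s v) = c *s T v"
    "\<And>v w. T v \<bullet> w = v \<bullet> T w"
  obtains Y :: "(complex^'n) \<Rightarrow>\<^sub>L (complex^'n)"
  where "norm Y \<le> r" "\<And>c v. Y (c *s v) = c *s Y v" "\<And>v w. Y v \<bullet> w = v \<bullet> Y w"
    "\<And>v. 2 *\<^sub>R Y v = T v + Y (Y v)"
proof -
  define S where "S = {Y :: (complex^'n) \<Rightarrow>\<^sub>L (complex^'n). norm Y \<le> r \<and>
     (\<forall>c v. blinfun_apply Y (c *s v) = c *s blinfun_apply Y v) \<and>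
     (\<forall>v w. blinfun_apply Y v \<bullet> w = v \<bullet> blinfun_apply Y w)}"
  define f where "f Y = (1/2) *\<^sub>R (T + (Y o\<^sub>L Y))" for Y :: "(complex^'n) \<Rightarrow>\<^sub>L (complex^'n)"
  have "complete S"
    using closed_symmetric_complex_blinfun by (simp add: complete_eq_closed S_def)
  moreover have "S \<noteq> {}"
    using r by (auto simp: S_def intro!: exI [of _ 0])
  moreover have "f ` S \<subseteq> S"
  proof (rule image_subsetI)
    fix Y assume Y: "Y \<in> S"
    have "norm (Y o\<^sub>L Y) \<le> norm Y * norm Y" by (rule norm_blinfun_compose)
    also have "\<dots> \<le> 1 * r" using Y r by (intro mult_mono) (auto simp: S_def)
    finally have "norm (T + (Y o\<^sub>L Y)) \<le> 2 * r"
      using T(1) norm_triangle_ineq [of T "Y o\<^sub>L Y"] by simp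
    moreover have "(1/2) *\<^sub>R (c *s x + c *s y) = c *s ((1/2) *\<^sub>R (x + y))" for c and x y :: "complex^'n"
      by (simp add: vec_eq_iff algebra_simps)
    ultimately show "f Y \<in> S"
      using Y T by (simp add: S_def f_def blinfun.add_left blinfun.scaleR_left inner_add_left inner_add_right)
  qed
  moreover have "dist (f Y) (f Z) \<le> r * dist Y Z" if "Y \<in> S" "Z \<in> S" for Y Z
  proof -
    \<comment> \<open>Noncommutative difference of squares; both summands are at most
      \<open>r\<close> times the distance, and the factor 1/2 averages them.\<close>
    have "f Y - f Z = (1/2) *\<^sub>R ((Y o\<^sub>L (Y - Z)) + ((Y - Z) o\<^sub>L Z))"
      by (rule blinfun_eqI) (simp add: f_def blinfun.bilinear_simps algebra_simps)
    moreover have "norm (Y o\<^sub>L (Y - Z)) \<le> r * norm (Y - Z)"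
      using that by (intro order_trans [OF norm_blinfun_compose] mult_right_mono) (auto simp: S_def)
    moreover have "norm ((Y - Z) o\<^sub>L Z) \<le> norm (Y - Z) * r"
      using that by (intro order_trans [OF norm_blinfun_compose] mult_left_mono) (auto simp: S_def)
    ultimately show ?thesis
      using norm_triangle_ineq [of "Y o\<^sub>L (Y - Z)" "(Y - Z) o\<^sub>L Z"] by (simp add: dist_norm mult.commute)
  qed
  ultimately obtain Y where Y: "Y \<in> S" "f Y = Y"
    using Banach_fix [of S r f] r by blast
  have "2 *\<^sub>R Y v = T v + Y (Y v)" for v
  proof -
    have "2 *\<^sub>R f Y v = T v + Y (Y v)"
      by (simp add: f_def blinfun.bilinear_simps)
    then show ?thesis by (simp add: Y(2))
  qed
  with Y(1) show ?thesis using that by (auto simp: S_def)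
qed

text \<open>After scaling, \<open>T = 1 - P / g\<close> has norm at most some \<open>r < 1\<close>.
  The contraction yields \<open>Y\<close> with \<open>(1 - Y)^2 = P / g\<close>, and
  \<open>B = sqrt g * (1 - Y)\<close> is the root; \<open>norm Y \<le> r\<close> bounds it
  below.\<close>

lemma posdef_sqrt_exists:
  fixes P :: "complex^'n^'n"
  assumes P: "cadjoint P = P" and m: "m > 0" "\<And>v. m * (v \<bullet> v) \<le> v \<bullet> (P *v v)"
  obtains B c where "cadjoint B = B" "B ** B = P" "c > 0" "\<And>v. c * (v \<bullet> v) \<le> v \<bullet> (B *v v)"
proof -
  have blP: "bounded_linear ((*v) P)"
    by (simp add: linear_conv_bounded_linear [symmetric] linear_iff vec_eq_iff
        matrix_vector_mult_def algebra_simps sum.distrib scaleR_sum_right)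
  then obtain K where K: "K > 0" "\<And>v. norm (P *v v) \<le> norm v * K"
    using bounded_linear.pos_bounded by blast
  \<comment> \<open>Adding \<open>m\<close> to the operator bound forces \<open>m < M\<close>, so
    that the radicand in \<open>r\<close> is positive.\<close>
  define M where "M = K + m"
  have M: "M > 0" "m < M" and PM: "norm (P *v v) \<le> M * norm v" for v
    using K(1) m(1) K(2) [of v] by (auto simp: M_def distrib_left mult.commute add_increasing2)
  \<comment> \<open>This \<open>g\<close> minimises \<open>1 - 2 * m / g + M^2 / g^2\<close>, the
    bound for the squared norm of \<open>T\<close>; the minimum is the square of
    \<open>r\<close>.\<close>
  define g where "g = M\<^sup>2 / m"
  have g: "g > 0" using M m by (simp add: g_def)
  define r where "r = sqrt (1 - (m / M)\<^sup>2)"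
  have mM: "(m / M)\<^sup>2 > 0" "(m / M)\<^sup>2 < 1"
    using m(1) M by (auto simp: power_less_one_iff)
  then have r: "0 \<le> r" "r < 1" by (auto simp: r_def)
  define T where "T = Blinfun (\<lambda>v. v - (1 / g) *\<^sub>R (P *v v))"
  have T_apply: "T v = v - (1 / g) *\<^sub>R (P *v v)" for v
    unfolding T_def
    by (subst bounded_linear_Blinfun_apply) (rule bounded_linear_sub [OF bounded_linear_ident
        bounded_linear_compose [OF bounded_linear_scaleR_right blP]], rule refl)
  have "norm (T v) \<le> r * norm v" for v
  proof -
    have "(norm (T v))\<^sup>2 = v \<bullet> v - 2 / g * (v \<bullet> (P *v v)) + (norm (P *v v))\<^sup>2 / g\<^sup>2"
      unfolding T_apply power2_norm_eq_inner
      by (simp add: inner_diff_left inner_diff_right inner_commute power2_eq_square)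
    also have "\<dots> \<le> v \<bullet> v - 2 / g * (m * (v \<bullet> v)) + (M * norm v)\<^sup>2 / g\<^sup>2"
      using g by (intro add_mono diff_mono mult_left_mono divide_right_mono power_mono m(2) PM order_refl) auto
    also have "\<dots> = (1 - (m / M)\<^sup>2) * (v \<bullet> v)"
    proof -
      have "N - 2 / g * (m * N) + (M\<^sup>2 * N) / g\<^sup>2 = (1 - (m / M)\<^sup>2) * N" for N
        using m(1) M(1) by (simp add: g_def field_simps power2_eq_square)
      then show ?thesis by (simp only: power_mult_distrib power2_norm_eq_inner)
    qed
    also have "\<dots> = (r * norm v)\<^sup>2"
      using mM by (simp add: r_def power_mult_distrib power2_norm_eq_inner)
    finally show ?thesis by (rule power2_le_imp_le) (simp add: r)
  qed
  then have T1: "norm T \<le> r" using r(1) by (intro norm_blinfun_bound) auto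
  have T2: "T (c *s v) = c *s T v" for c v
    by (simp add: T_apply vector_scalar_commute) (simp add: vec_eq_iff algebra_simps)
  have T3: "T v \<bullet> w = v \<bullet> T w" for v w
    using inner_cadjoint_vec [of v P w] P by (simp add: T_apply inner_diff_left inner_diff_right)
  obtain Y :: "(complex^'n) \<Rightarrow>\<^sub>L (complex^'n)"
    where Y: "norm Y \<le> r" "\<And>c v. Y (c *s v) = c *s Y v" "\<And>v w. Y v \<bullet> w = v \<bullet> Y w"
      "\<And>v. 2 *\<^sub>R Y v = T v + Y (Y v)"
    by (rule contraction_sqrt [OF r T1 T2 T3]) (rule that; assumption)
  define B where "B = matrix (\<lambda>v. sqrt g *\<^sub>R (v - Y v))"
  \<comment> \<open>Complex linearity of \<open>Y\<close> is what allows \<open>matrix\<close> to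
    represent the map.\<close>
  have "Vector_Spaces.linear (*s) (*s) (\<lambda>v. sqrt g *\<^sub>R (v - Y v))"
    by unfold_locales (simp_all add: Y(2) blinfun.add_right vec_eq_iff algebra_simps)
  then have B: "B *v v = sqrt g *\<^sub>R (v - Y v)" for v
    unfolding B_def by (rule matrix_works)
  show ?thesis
  proof
    show "cadjoint B = B"
    proof (subst matrix_eq, rule allI, rule vector_eq_ldot [THEN iffD1], rule allI)
      fix x y
      have "y \<bullet> (cadjoint B *v x) = (B *v y) \<bullet> x"
        by (simp add: inner_cadjoint_vec)
      also have "\<dots> = y \<bullet> (B *v x)"
        by (simp add: B inner_diff_left inner_diff_right Y(3))
      finally show "y \<bullet> (cadjoint B *v x) = y \<bullet> (B *v x)" .
    qed
    show "B ** B = P"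
    proof (subst matrix_eq, rule allI)
      fix v
      have "(B ** B) *v v = g *\<^sub>R (v - (2 *\<^sub>R Y v - Y (Y v)))"
        using g by (simp add: matrix_vector_mul_assoc [symmetric] B blinfun.bilinear_simps
            scaleR_diff_right scaleR_add_right scaleR_2)
      also have "\<dots> = P *v v"
        using g by (simp add: Y(4) T_apply)
      finally show "(B ** B) *v v = P *v v" .
    qed
    show "sqrt g * (1 - r) > 0" using g r by simp
    show "sqrt g * (1 - r) * (v \<bullet> v) \<le> v \<bullet> (B *v v)" for v
    proof -
      have "v \<bullet> Y v \<le> norm v * norm (Y v)" by (rule norm_cauchy_schwarz)
      also have "\<dots> \<le> norm v * (r * norm v)"
        by (intro mult_left_mono order_trans [OF norm_blinfun] mult_right_mono Y(1) norm_ge_zero)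
      finally have "v \<bullet> Y v \<le> r * (v \<bullet> v)"
        by (simp add: power2_norm_eq_inner [symmetric] power2_eq_square mult_ac)
      then have "sqrt g * ((1 - r) * (v \<bullet> v)) \<le> sqrt g * (v \<bullet> v - v \<bullet> Y v)"
        using g by (intro mult_left_mono) (auto simp: algebra_simps)
      then show ?thesis by (simp add: B inner_diff_right)
    qed
  qed
qed

text \<open>Invertibility bounds the Gram matrix below, which gives a coercive root
  \<open>B\<close>. Any other positive semidefinite root must equal \<open>B\<close>, so the
  definite description in \<open>matrix_sqrt\<close> denotes it.\<close>

lemma
  fixes X :: "complex^'n^'n"
  assumes "invertible X"
  shows pos_semidef_matrix_abs: "pos_semidef (matrix_abs X)"
    and matrix_abs_square: "matrix_abs X ** matrix_abs X = cadjoint X ** X"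
    and matrix_abs_coercive: "\<exists>c>0. \<forall>v. c * (v \<bullet> v) \<le> v \<bullet> (matrix_abs X *v v)"
proof -
  have "linear ((*v) X)"
    by (simp add: linear_iff vec_eq_iff matrix_vector_mult_def algebra_simps sum.distrib scaleR_sum_right)
  moreover have "inj ((*v) X)" using assms by (rule inj_matrix_vector_mult)
  ultimately obtain b where b: "b > 0" "\<And>v. b * norm v \<le> norm (X *v v)"
    using linear_inj_bounded_below_pos by blast
  have lower: "b\<^sup>2 * (v \<bullet> v) \<le> v \<bullet> ((cadjoint X ** X) *v v)" for v
  proof -
    have "(b * norm v)\<^sup>2 \<le> (norm (X *v v))\<^sup>2" using b by (intro power_mono) auto
    then show ?thesis
      by (simp add: matrix_vector_mul_assoc [symmetric] inner_cadjoint_vec power_mult_distrib power2_norm_eq_inner)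
  qed
  obtain B c where B: "cadjoint B = B" "B ** B = cadjoint X ** X" "c > 0"
      "\<And>v. c * (v \<bullet> v) \<le> v \<bullet> (B *v v)"
    by (rule posdef_sqrt_exists [OF _ _ lower]) (use b(1) in \<open>simp_all add: cadjoint_matrix_mul\<close>)
  have psd: "pos_semidef B"
    unfolding pos_semidef_iff using B(1)
      order_trans [OF mult_nonneg_nonneg [OF less_imp_le [OF B(3)] inner_ge_zero] B(4)] by blast
  have "B' = B" if "pos_semidef B'" "B' ** B' = cadjoint X ** X" for B'
  proof -
    \<comment> \<open>The difference of the two squares, written as a Sylvester expression in
      \<open>B' - B\<close>; coercivity of \<open>B\<close> then forces
      \<open>B' = B\<close>.\<close>
    have "(B' - B) ** B' + B ** (B' - B) = 0"
      using that B(2) by (simp add: bounded_bilinear.diff_left [OF bounded_bilinear_matrix_mul]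
          bounded_bilinear.diff_right [OF bounded_bilinear_matrix_mul])
    then have "c * norm (B' - B) \<le> 0"
      using norm_Sylvester_ge [OF B(4) that(1), of "B' - B"] by simp
    then show ?thesis using \<open>c > 0\<close> by (simp add: mult_le_0_iff)
  qed
  then have "matrix_abs X = B"
    unfolding matrix_abs_def matrix_sqrt_def using psd B(2) by (intro the_equality conjI) blast+
  then show "pos_semidef (matrix_abs X)" "matrix_abs X ** matrix_abs X = cadjoint X ** X"
    "\<exists>c>0. \<forall>v. c * (v \<bullet> v) \<le> v \<bullet> (matrix_abs X *v v)"
    using psd B by (simp, simp, blast)
qed

section \<open>Smoothness of products and openness of the invertible matrices\<close>

lemma differentiable_bounded_bilinear:
  assumes "bounded_bilinear b" "f differentiable (at x)" "g differentiable (at x)"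
  shows "(\<lambda>x. b (f x) (g x)) differentiable (at x)"
proof -
  obtain f' g' where "(f has_derivative f') (at x)" "(g has_derivative g') (at x)"
    using assms(2,3) unfolding differentiable_def by blast
  from differentiableI [OF bounded_bilinear.FDERIV [OF assms(1) this]] show ?thesis .
qed

lemma ndiff_bounded_bilinear_differentiable:
  assumes b: "bounded_bilinear b" and S: "open S" "x \<in> S"
    and f: "\<And>j x. x \<in> S \<Longrightarrow> ndiff j f H differentiable (at x)"
    and g: "\<And>j x. x \<in> S \<Longrightarrow> ndiff j g H differentiable (at x)"
  shows "ndiff k (\<lambda>x. b (f x) (g x)) H differentiable (at x)"
proof (rule differentiable_cong_open [THEN iffD2, OF S])
  show "ndiff k (\<lambda>x. b (f x) (g x)) H y =
      (\<Sum>j\<le>k. real (k choose j) *\<^sub>R b (ndiff j f H y) (ndiff (k - j) g H y))" if "y \<in> S" for y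
    using that f g by (intro ndiff_bounded_bilinear [OF b S(1)])
  show "(\<lambda>y. \<Sum>j\<le>k. real (k choose j) *\<^sub>R b (ndiff j f H y) (ndiff (k - j) g H y)) differentiable (at x)"
  proof (rule differentiable_sum, simp, intro ballI differentiable_scaleR differentiable_const)
    fix j
    show "(\<lambda>y. b (ndiff j f H y) (ndiff (k - j) g H y)) differentiable (at x)"
      by (rule differentiable_bounded_bilinear [OF b f [OF S(2)] g [OF S(2)]])
  qed
qed

lemma open_invertible: "open {X :: complex^'n^'n. invertible X}"
proof -
  have "(\<lambda>X :: complex^'n^'n. det X) differentiable (at X)" for X
    by (intro differentiable_det differentiable_nth differentiable_ident)
  then have "continuous_on UNIV (\<lambda>X :: complex^'n^'n. det X)"
    by (simp add: continuous_on_eq_continuous_at differentiable_imp_continuous_within)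
  then have "open {X :: complex^'n^'n. det X \<noteq> 0}"
    by (intro open_Collect_neq continuous_on_const)
  then show ?thesis by (simp add: invertible_det_nz)
qed

section \<open>Vectorization and the Kronecker sum\<close>

lemma mvec_nth [simp]: "mvec Z $ p = Z $ snd p $ fst p"
  by (simp add: mvec_def)

lemma mvec_eq_iff: "mvec Y = mvec Z \<longleftrightarrow> Y = Z"
  by (auto simp: vec_eq_iff)

lemma bounded_linear_mvec: "bounded_linear (mvec :: complex^'n^'m \<Rightarrow> _)"
  by (simp add: linear_conv_bounded_linear [symmetric] linear_iff vec_eq_iff)

lemma bounded_linear_kronecker_sum:
  "bounded_linear (kronecker_sum :: complex^'n^'n \<Rightarrow> _)"
  by (simp add: linear_conv_bounded_linear [symmetric] linear_iff vec_eq_iff kronecker_sum_def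
      kronecker_def transpose_def algebra_simps)

text \<open>The Kronecker sum is the Sylvester operator in coordinates: the identity factor in each
  Kronecker product is a delta that removes one of the two sums.\<close>

lemma kronecker_sum_mvec:
  fixes Y Z :: "'a::comm_ring_1^'n^'n"
  shows "kronecker_sum Y *v mvec Z = mvec (Z ** Y + Y ** Z)"
proof (subst vec_eq_iff, rule allI)
  fix p :: "'n \<times> 'n"
  obtain j i where p: "p = (j, i)" by (cases p)
  have "(kronecker_sum Y *v mvec Z) $ p =
     (\<Sum>(l, k)\<in>UNIV \<times> UNIV. (Y $ l $ j * mat 1 $ i $ k + mat 1 $ j $ l * Y $ i $ k) * Z $ k $ l)"
    by (simp add: matrix_vector_mult_def kronecker_sum_def kronecker_def transpose_def p case_prod_beta)
  also have "\<dots> = (\<Sum>l\<in>UNIV. \<Sum>k\<in>UNIV. (Y $ l $ j * mat 1 $ i $ k + mat 1 $ j $ l * Y $ i $ k) * Z $ k $ l)"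
    by (rule sum.cartesian_product [symmetric])
  also have "\<dots> = (\<Sum>l\<in>UNIV. \<Sum>k\<in>UNIV. (Y $ l $ j * mat 1 $ i $ k) * Z $ k $ l) +
      (\<Sum>l\<in>UNIV. \<Sum>k\<in>UNIV. (mat 1 $ j $ l * Y $ i $ k) * Z $ k $ l)"
    by (simp only: distrib_right sum.distrib)
  also have "(\<Sum>l\<in>UNIV. \<Sum>k\<in>UNIV. (Y $ l $ j * mat 1 $ i $ k) * Z $ k $ l) = (Z ** Y) $ i $ j"
    by (simp add: mat_def matrix_matrix_mult_def if_distrib [of "(*) _"]
        if_distrib [of "\<lambda>x. x * _"] mult.commute [of "Z $ i $ _"] cong: if_cong)
  also have "(\<Sum>l\<in>UNIV. \<Sum>k\<in>UNIV. (mat 1 $ j $ l * Y $ i $ k) * Z $ k $ l) = (Y ** Z) $ i $ j"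
    by (subst sum.swap) (simp add: mat_def matrix_matrix_mult_def if_distrib [of "\<lambda>x. x * _ * _"]
        if_distrib [of "\<lambda>x. x * _"] cong: if_cong)
  finally show "(kronecker_sum Y *v mvec Z) $ p = mvec (Z ** Y + Y ** Z) $ p"
    by (simp add: p)
qed

lemma Sylvester_matrix_abs_eq_0:
  fixes X Z :: "complex^'n^'n"
  assumes "invertible X" and "Z ** matrix_abs X + matrix_abs X ** Z = 0"
  shows "Z = 0"
proof -
  obtain c where c: "c > 0" "\<And>v. c * (v \<bullet> v) \<le> v \<bullet> (matrix_abs X *v v)"
    using matrix_abs_coercive [OF assms(1)] by blast
  show ?thesis
    using norm_Sylvester_ge [OF c(2) pos_semidef_matrix_abs [OF assms(1)], of Z] assms(2) c(1)
    by (simp add: mult_le_0_iff)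
qed

text \<open>Every vector is some \<open>mvec Z\<close>, so a kernel vector is a solution of the
  homogeneous Sylvester equation, hence zero; for a square matrix a trivial kernel suffices.\<close>

lemma invertible_kronecker_sum_matrix_abs:
  fixes X :: "complex^'n^'n"
  assumes "invertible X"
  shows "invertible (kronecker_sum (matrix_abs X))"
proof -
  have "z = 0" if z: "kronecker_sum (matrix_abs X) *v z = 0" for z :: "complex^('n \<times> 'n)"
  proof -
    define Z :: "complex^'n^'n" where "Z = (\<chi> i j. z $ (j, i))"
    have zZ: "z = mvec Z" by (simp add: Z_def vec_eq_iff)
    have mvec_0: "mvec (0 :: complex^'n^'n) = 0" by (simp add: vec_eq_iff)
    have "mvec (Z ** matrix_abs X + matrix_abs X ** Z) = mvec 0"
      using z unfolding zZ kronecker_sum_mvec mvec_0 .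
    then have "Z = 0"
      unfolding mvec_eq_iff by (rule Sylvester_matrix_abs_eq_0 [OF assms])
    then show ?thesis by (simp add: zZ mvec_0)
  qed
  then show ?thesis
    by (simp add: invertible_left_inverse matrix_left_invertible_ker)
qed

lemma invertible_matrix_abs:
  fixes X :: "complex^'n^'n"
  assumes "invertible X"
  shows "invertible (matrix_abs X)"
proof -
  obtain c where c: "c > 0" "\<And>v. c * (v \<bullet> v) \<le> v \<bullet> (matrix_abs X *v v)"
    using matrix_abs_coercive [OF assms] by blast
  have "v = 0" if "matrix_abs X *v v = 0" for v
  proof -
    have "v \<bullet> v \<le> 0" using c(1) c(2) [of v] that by (simp add: mult_le_0_iff)
    then show ?thesis by (metis inner_gt_zero_iff not_le)
  qed
  then show ?thesis
    by (simp add: invertible_left_inverse matrix_left_invertible_ker)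
qed

lemma cadjoint_matrix_abs: "invertible X \<Longrightarrow> cadjoint (matrix_abs X) = matrix_abs X"
  using pos_semidef_matrix_abs by (auto simp: pos_semidef_iff)


section \<open>Smoothness of the absolute value\<close>

text \<open>The difference quotient of \<open>h\<close> is at most \<open>a\<close> times that of
  \<open>g\<close>. This disposes of the quadratic remainder in the first-order expansion of
  \<open>matrix_abs\<close>.\<close>

lemma has_derivative_zero_dominated:
  assumes g: "(g has_derivative (\<lambda>_. 0)) (at x)" and "g x = 0" "h x = 0" and S: "open S" "x \<in> S"
    and le: "\<And>y. y \<in> S \<Longrightarrow> norm (h y) \<le> norm (g y) * a"
  shows "(h has_derivative (\<lambda>_. 0)) (at x)"
  unfolding has_derivative_iff_norm
proof
  have "((\<lambda>y. norm (g y) / norm (y - x)) \<longlongrightarrow> 0) (at x)"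
    using g \<open>g x = 0\<close> by (simp add: has_derivative_iff_norm)
  moreover have "\<forall>\<^sub>F y in at x. norm (norm (h y) / norm (y - x)) \<le> norm (norm (g y) / norm (y - x)) * a"
    using eventually_at_in_open' [OF S]
  proof eventually_elim
    case (elim y)
    then show ?case using divide_right_mono [OF le norm_ge_zero [of "y - x"]] by simp
  qed
  ultimately show "((\<lambda>y. norm (h y - h x - 0) / norm (y - x)) \<longlongrightarrow> 0) (at x)"
    using \<open>h x = 0\<close> by (simp add: tendsto_0_le)
qed simp

lemma gram_differentiable:
  "(\<lambda>Y :: complex^'n^'m. cadjoint Y ** Y) differentiable (at X)"
  by (rule differentiable_bounded_bilinear [OF bounded_bilinear_matrix_mul
      differentiable_bounded_linear [OF bounded_linear_cadjoint differentiable_ident] differentiable_ident])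

text \<open>The increment \<open>E = |Y| - |X|\<close> satisfies \<open>E |Y| + |X| E = Q\<close> with \<open>Q = Y\<^sup>\<dagger> Y - X\<^sup>\<dagger> X\<close>, so that
  \<open>E = O(Q)\<close> by coercivity. Since also \<open>E |X| + |X| E = Q - E\<^sup>2\<close>, inverting the Sylvester operator
  of \<open>|X|\<close> makes \<open>E\<close> linear in \<open>Q\<close> up to second order.\<close>

lemma matrix_abs_differentiable:
  fixes X :: "complex^'n^'n"
  assumes "invertible X"
  shows "matrix_abs differentiable (at X)"
proof -
  note mul = bounded_bilinear_matrix_mul
  define S where "S = {X :: complex^'n^'n. invertible X}"
  have S: "open S" "X \<in> S" using assms open_invertible by (simp_all add: S_def)
  define B where "B = matrix_abs X"
  define L where "L Z = Z ** B + B ** Z" for Z :: "complex^'n^'n"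
  define Q where "Q Y = cadjoint Y ** Y - cadjoint X ** X" for Y :: "complex^'n^'n"
  define E where "E Y = matrix_abs Y - B" for Y :: "complex^'n^'n"
  have "bounded_linear L"
    unfolding L_def by (intro bounded_linear_add bounded_bilinear.bounded_linear_left [OF mul]
      bounded_bilinear.bounded_linear_right [OF mul])
  then have L: "linear L" by (rule bounded_linear.linear)
  moreover have "inj L"
  proof (subst linear_injective_0 [OF L], intro allI impI)
    fix Z assume "L Z = 0"
    then show "Z = 0"
      unfolding L_def B_def by (rule Sylvester_matrix_abs_eq_0 [OF assms])
  qed
  ultimately have "\<exists>M. linear M \<and> M \<circ> L = id"
    by (rule linear_injective_left_inverse)
  then obtain M where lM: "linear M" and MoL: "M \<circ> L = id" by blast
  have bM: "bounded_linear M" using lM by (simp add: linear_conv_bounded_linear)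
  obtain c where c: "c > 0" "\<And>v. c * (v \<bullet> v) \<le> v \<bullet> (B *v v)"
    using matrix_abs_coercive [OF assms] unfolding B_def by blast
  obtain K where K: "K > 0" "\<And>(Y :: complex^'n^'n) (Z :: complex^'n^'n). norm (Y ** Z) \<le> norm Y * norm Z * K"
    using bounded_bilinear.pos_bounded [OF mul] by blast
  have Q_E: "E Y ** matrix_abs Y + B ** E Y = Q Y" "L (E Y) = Q Y - E Y ** E Y" if "Y \<in> S" for Y
  proof -
    have "Q Y = matrix_abs Y ** matrix_abs Y - B ** B"
      using that S(2) by (simp only: Q_def B_def S_def mem_Collect_eq matrix_abs_square)
    then show "E Y ** matrix_abs Y + B ** E Y = Q Y" "L (E Y) = Q Y - E Y ** E Y"
      by (simp_all add: E_def L_def bounded_bilinear.diff_left [OF mul] bounded_bilinear.diff_right [OF mul])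
  qed
  have E_le: "norm (E Y) \<le> norm (Q Y) / c" if "Y \<in> S" for Y
  proof -
    have "c * norm (E Y) \<le> norm (E Y ** matrix_abs Y + B ** E Y)"
      using that by (intro norm_Sylvester_ge [OF c(2) pos_semidef_matrix_abs]) (simp add: S_def)
    then show ?thesis
      using c(1) by (simp only: Q_E(1) [OF that] pos_le_divide_eq mult.commute)
  qed
  have E2_le: "norm (E Y ** E Y) \<le> norm (Q Y \<bullet> Q Y) * (K / c\<^sup>2)" if "Y \<in> S" for Y
  proof -
    have "norm (E Y ** E Y) \<le> norm (E Y) * norm (E Y) * K" by (rule K(2))
    also have "\<dots> \<le> (norm (Q Y) / c) * (norm (Q Y) / c) * K"
      using K(1) c(1) by (intro mult_right_mono mult_mono E_le that) auto
    finally show ?thesis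
      by (simp add: power2_norm_eq_inner [symmetric] power2_eq_square)
  qed
  have Q: "Q differentiable (at X)"
    unfolding Q_def by (intro differentiable_diff gram_differentiable differentiable_const)
  then obtain Q' where Q': "(Q has_derivative Q') (at X)" by (auto simp: differentiable_def)
  have QX: "Q X = 0" by (simp add: Q_def)
  \<comment> \<open>The remainder is compared with \<open>Q Y \<bullet> Q Y\<close>, whose
    derivative at \<open>X\<close> vanishes by the product rule because
    \<open>Q X = 0\<close>.\<close>
  have "((\<lambda>Y. Q Y \<bullet> Q Y) has_derivative (\<lambda>_. 0)) (at X)"
    using has_derivative_inner [OF Q' Q'] by (simp only: QX inner_zero_left inner_zero_right add_0)
  moreover have "E X ** E X = 0"
    by (simp add: E_def B_def bounded_bilinear.zero_left [OF mul])
  ultimately have "((\<lambda>Y. E Y ** E Y) has_derivative (\<lambda>_. 0)) (at X)"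
    by (intro has_derivative_zero_dominated [OF _ _ _ S E2_le]) (simp_all only: QX inner_zero_left)
  then have "(\<lambda>Y. E Y ** E Y) differentiable (at X)" by (rule differentiableI)
  then have diff: "(\<lambda>Y. B + M (Q Y - E Y ** E Y)) differentiable (at X)"
    by (intro differentiable_add differentiable_const differentiable_bounded_linear [OF bM]
        differentiable_diff Q)
  have "matrix_abs Y = B + M (Q Y - E Y ** E Y)" if "Y \<in> S" for Y
    using fun_cong [OF MoL, of "E Y"] unfolding o_apply Q_E(2) [OF that] by (simp add: E_def)
  then show ?thesis by (rule differentiable_cong_open [THEN iffD2, OF S _ diff])
qed

text \<open>Vectorizing turns the equation into a linear system with matrix
  \<open>kronecker_sum (A y)\<close>, to which Cramer's rule applies.\<close>

lemma Sylvester_solution_differentiable: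
  fixes A F Z :: "'a::real_normed_vector \<Rightarrow> complex^'n^'n"
  assumes S: "open S" "x \<in> S" and A: "A differentiable (at x)" and F: "F differentiable (at x)"
    and inv: "invertible (kronecker_sum (A x))"
    and eq: "\<And>y. y \<in> S \<Longrightarrow> Z y ** A y + A y ** Z y = F y"
  shows "Z differentiable (at x)"
proof -
  have "(\<lambda>y. mvec (Z y)) differentiable (at x)"
    using inv by (intro differentiable_solution [OF S differentiable_bounded_linear [OF bounded_linear_kronecker_sum A]
          differentiable_bounded_linear [OF bounded_linear_mvec F]]) (simp_all add: kronecker_sum_mvec eq)
  then have "(\<lambda>y. mvec (Z y) $ (j, i)) differentiable (at x)" for i j
    by (rule differentiable_nth)
  then show ?thesis
    by (intro differentiable_vecI) simp
qed

section \<open>Differentials of the Gram matrix and of the square\<close>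

lemma ndiff_cadjoint_eq:
  fixes H X :: "complex^'n^'m"
  shows "ndiff k cadjoint H X = cadjoint (ndiff k (\<lambda>Y. Y) H X)"
  by (rule ndiff_bounded_linear [OF bounded_linear_cadjoint open_UNIV UNIV_I ndiff_id_differentiable])

lemma ndiff_gram_differentiable:
  "ndiff k (\<lambda>Y :: complex^'n^'m. cadjoint Y ** Y) H differentiable (at X)"
  by (rule ndiff_bounded_bilinear_differentiable [OF bounded_bilinear_matrix_mul open_UNIV UNIV_I
      ndiff_bounded_linear_differentiable [OF bounded_linear_cadjoint open_UNIV UNIV_I ndiff_id_differentiable]
      ndiff_id_differentiable])

text \<open>For order at least 3, each Leibniz term has a factor of order at least 2, which
  vanishes.\<close>

lemma ndiff_gram_eq_0:
  fixes H X :: "complex^'n^'m"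
  assumes "k \<ge> 3"
  shows "ndiff k (\<lambda>Y. cadjoint Y ** Y) H X = 0"
proof -
  have high: "ndiff j (\<lambda>Y. Y) H X = 0" if "j \<ge> 2" for j
    using ndiff_id(3) [of "j - 2" H X] that by (simp add: numeral_2_eq_2 Suc_diff_Suc del: ndiff.simps(2))
  have "ndiff k (\<lambda>Y. cadjoint Y ** Y) H X =
      (\<Sum>j\<le>k. real (k choose j) *\<^sub>R (ndiff j cadjoint H X ** ndiff (k - j) (\<lambda>Y. Y) H X))"
    by (rule ndiff_bounded_bilinear [OF bounded_bilinear_matrix_mul open_UNIV UNIV_I
      ndiff_bounded_linear_differentiable [OF bounded_linear_cadjoint open_UNIV UNIV_I ndiff_id_differentiable]
      ndiff_id_differentiable])
  also have "\<dots> = 0"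
  proof (rule sum.neutral, intro ballI)
    fix j
    have "cadjoint (0 :: complex^'n^'m) = 0" by (simp add: vec_eq_iff)
    moreover have "j \<ge> 2 \<or> k - j \<ge> 2" using assms by linarith
    ultimately show "real (k choose j) *\<^sub>R (ndiff j cadjoint H X ** ndiff (k - j) (\<lambda>Y. Y) H X) = 0"
      unfolding ndiff_cadjoint_eq using high
      by (auto simp: bounded_bilinear.zero_left [OF bounded_bilinear_matrix_mul]
          bounded_bilinear.zero_right [OF bounded_bilinear_matrix_mul])
  qed
  finally show ?thesis .
qed

text \<open>For \<open>n > 0\<close> the indices \<open>0\<close> and \<open>n\<close> differ, so
  exactly the two terms containing \<open>D n\<close> are split off.\<close>

lemma sum_square_term:
  assumes "n > 0"
  shows "(\<Sum>k=0..n. square_term n D k) = D n ** D 0 + D 0 ** D n - rhs_matrix n D"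
proof -
  have "(\<Sum>k=0..n. square_term n D k) =
      (\<Sum>k\<in>{0..n} - {0, n}. square_term n D k) + (\<Sum>k\<in>{0, n}. square_term n D k)"
    by (rule sum.subset_diff) auto
  then show ?thesis using assms by (simp add: rhs_matrix_def square_term_def)
qed

text \<open>Strictly between \<open>0\<close> and \<open>n\<close>, both \<open>k\<close> and
  \<open>n - k\<close> lie in \<open>{1..<n}\<close>. This makes precise that the right-hand side
  contains lower orders only.\<close>

lemma rhs_matrix_cong:
  assumes "\<And>k. k \<in> {1..<n} \<Longrightarrow> D' k = D k"
  shows "rhs_matrix n D' = rhs_matrix n D"
proof -
  have "square_term n D' k = square_term n D k" if "k \<in> {0..n} - {0, n}" for k
  proof -
    have "k \<in> {1..<n}" "n - k \<in> {1..<n}" using that by auto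
    then show ?thesis by (simp only: assms square_term_def)
  qed
  then show ?thesis by (simp add: rhs_matrix_def)
qed

lemma ndiff_matrix_abs_square:
  fixes H X :: "complex^'n^'n"
  assumes "invertible X"
  shows "ndiff k (\<lambda>Y. matrix_abs Y ** matrix_abs Y) H X = ndiff k (\<lambda>Y. cadjoint Y ** Y) H X"
  by (rule ndiff_cong_open [OF open_invertible]) (simp_all add: assms matrix_abs_square)

text \<open>The induction covers all invertible \<open>X\<close> at once, since the Leibniz rule at
  order \<open>k\<close> needs the lower orders to be differentiable on an open set.\<close>

lemma ndiff_matrix_abs_differentiable:
  fixes H X :: "complex^'n^'n"
  assumes "invertible X"
  shows "ndiff k matrix_abs H differentiable (at X)"
  using assms
proof (induction k arbitrary: X rule: less_induct)
  case (less k)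
  define S where "S = {X :: complex^'n^'n. invertible X}"
  have S: "open S" "X \<in> S" using less.prems open_invertible by (simp_all add: S_def)
  show ?case
  proof (cases "k = 0")
    case True
    \<comment> \<open>At order 0 the equation is quadratic in the unknown, so Cramer's rule does not
      apply and the direct argument is used.\<close>
    then show ?thesis using matrix_abs_differentiable [OF less.prems] by simp
  next
    case False
    let ?D = "\<lambda>Y j. ndiff j matrix_abs H Y"
    \<comment> \<open>The differential of the Gram matrix stays in the right-hand side because it
      need not vanish for \<open>k < 3\<close>.\<close>
    define F where "F Y = ndiff k (\<lambda>Y. cadjoint Y ** Y) H Y + rhs_matrix k (?D Y)" for Y
    have eq: "ndiff k matrix_abs H Y ** matrix_abs Y + matrix_abs Y ** ndiff k matrix_abs H Y = F Y"
      if "Y \<in> S" for Y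
    proof -
      have "ndiff k (\<lambda>Y. cadjoint Y ** Y) H Y = (\<Sum>j=0..k. square_term k (?D Y) j)"
        unfolding ndiff_matrix_abs_square [of Y, symmetric, OF that [unfolded S_def mem_Collect_eq]]
          square_term_def atLeast0AtMost
        by (rule ndiff_bounded_bilinear [OF bounded_bilinear_matrix_mul S(1) that])
          (simp_all add: less.IH S_def)
      then show ?thesis using False by (simp add: sum_square_term F_def)
    qed
    have "(\<lambda>Y. ndiff j matrix_abs H Y ** ndiff (k - j) matrix_abs H Y) differentiable (at X)"
      if "j \<in> {0..k} - {0, k}" for j
      using that by (intro differentiable_bounded_bilinear [OF bounded_bilinear_matrix_mul]
          less.IH [OF _ less.prems]) auto
    then have "(\<lambda>Y. rhs_matrix k (?D Y)) differentiable (at X)"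
      unfolding rhs_matrix_def square_term_def
      by (intro differentiable_minus differentiable_sum ballI differentiable_scaleR differentiable_const) auto
    then have "F differentiable (at X)"
      unfolding F_def by (intro differentiable_add ndiff_gram_differentiable)
    then show ?thesis
      by (rule Sylvester_solution_differentiable [OF S matrix_abs_differentiable [OF less.prems] _
            invertible_kronecker_sum_matrix_abs [OF less.prems] eq])
  qed
qed

section \<open>The trace formula and the iterative solution\<close>

lemma bounded_linear_trace: "bounded_linear (trace :: complex^'n^'n \<Rightarrow> complex)"
  by (simp add: linear_conv_bounded_linear [symmetric] linear_iff trace_def sum.distrib scaleR_sum_right)

lemma
  assumes "invertible A"
  shows matrix_inv_right: "A ** matrix_inv A = mat 1" and matrix_inv_left: "matrix_inv A ** A = mat 1"
  using someI_ex [OF assms [unfolded invertible_def]] by (simp_all add: matrix_inv_def)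

text \<open>By cyclicity of the trace, each of the two summands contributes
  \<open>trace Z\<close>.\<close>

lemma trace_mul_inverse_commute:
  fixes A Z :: "'a::comm_ring_1^'n^'n"
  assumes "invertible A"
  shows "trace (matrix_inv A ** (Z ** A + A ** Z)) = 2 * trace Z"
proof -
  have "trace (matrix_inv A ** (Z ** A)) = trace ((Z ** A) ** matrix_inv A)"
    by (rule trace_mul_sym)
  also have "\<dots> = trace Z"
    by (simp add: matrix_mul_assoc [symmetric] matrix_inv_right assms)
  finally show ?thesis
    by (simp add: matrix_add_ldistrib trace_add matrix_mul_assoc matrix_inv_left assms)
qed

text \<open>The differentiability conjuncts ensure that the differentials are genuine, as
  \<open>frechet_derivative\<close> is an arbitrary choice where no derivative exists. Quantifying
  over \<open>D'\<close> expresses that \<open>C\<close> depends on orders \<open>1\<close> to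
  \<open>n - 1\<close> only.\<close>

theorem mainTheorem7:
  fixes X dX :: "complex^'m^'m" and n :: nat
    and D :: "nat \<Rightarrow> complex^'m^'m" and C :: "complex^'m^'m"
  assumes "invertible X" and "n \<ge> 3"
    and D_def: "D = (\<lambda>k. ndiff k matrix_abs dX X)"
    and C_def: "C = rhs_matrix n D"
  shows "(\<forall>k. ndiff k (matrix_abs :: complex^'m^'m \<Rightarrow> complex^'m^'m) dX differentiable (at X))
    \<and> (\<forall>k. ndiff k (trace_norm :: complex^'m^'m \<Rightarrow> real) dX differentiable (at X))
    \<and> ndiff n (\<lambda>Y. matrix_abs Y ** matrix_abs Y) dX X = ndiff n (\<lambda>Y. cadjoint Y ** Y) dX X
    \<and> ndiff n (\<lambda>Y. cadjoint Y ** Y) dX X = 0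
    \<and> ndiff n (\<lambda>Y. matrix_abs Y ** matrix_abs Y) dX X = (\<Sum>k=0..n. square_term n D k)
    \<and> D n ** matrix_abs X + matrix_abs X ** D n = C
    \<and> (\<forall>D'. (\<forall>k\<in>{1..<n}. D' k = D k) \<longrightarrow> rhs_matrix n D' = C)
    \<and> invertible (matrix_abs X)
    \<and> invertible (kronecker_sum (matrix_abs X))
    \<and> (\<forall>Z. Z ** matrix_abs X + matrix_abs X ** Z = C \<longleftrightarrow>
           mvec Z = matrix_inv (kronecker_sum (matrix_abs X)) *v mvec C)
    \<and> ndiff n (\<lambda>Y. mvec (matrix_abs Y)) dX X =
           matrix_inv (kronecker_sum (matrix_abs X)) *v mvec C
    \<and> complex_of_real (ndiff n trace_norm dX X) =
           1 / 2 * trace (matrix_inv (matrix_abs X) ** C)"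
proof -
  define S where "S = {X :: complex^'m^'m. invertible X}"
  have S: "open S" "X \<in> S" using assms(1) open_invertible by (simp_all add: S_def)
  have smooth: "ndiff k matrix_abs dX differentiable (at Y)" if "Y \<in> S" for k Y
    using that ndiff_matrix_abs_differentiable by (simp add: S_def)
  have Re_trace: "bounded_linear (\<lambda>A :: complex^'m^'m. Re (trace A))"
    by (rule bounded_linear_compose [OF bounded_linear_Re bounded_linear_trace])
  have tn: "trace_norm = (\<lambda>Y :: complex^'m^'m. Re (trace (matrix_abs Y)))"
    by (simp add: fun_eq_iff trace_norm_def)
  have tn_smooth: "ndiff k (trace_norm :: complex^'m^'m \<Rightarrow> real) dX differentiable (at X)" for k
    unfolding tn by (rule ndiff_bounded_linear_differentiable [OF Re_trace S smooth])
  have square: "ndiff n (\<lambda>Y. matrix_abs Y ** matrix_abs Y) dX X = ndiff n (\<lambda>Y. cadjoint Y ** Y) dX X"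
    using assms(1) by (rule ndiff_matrix_abs_square)
  have zero: "ndiff n (\<lambda>Y. cadjoint Y ** Y) dX X = 0"
    using assms(2) by (rule ndiff_gram_eq_0)
  have leibniz: "ndiff n (\<lambda>Y. matrix_abs Y ** matrix_abs Y) dX X = (\<Sum>k=0..n. square_term n D k)"
    unfolding D_def square_term_def atLeast0AtMost
    by (rule ndiff_bounded_bilinear [OF bounded_bilinear_matrix_mul S smooth smooth])
  have D0: "D 0 = matrix_abs X" by (simp add: D_def)
  have eq: "D n ** matrix_abs X + matrix_abs X ** D n = C"
    using sum_square_term [of n D] assms(2) leibniz square zero by (simp add: C_def D0)
  have lower: "rhs_matrix n D' = C" if "\<forall>k\<in>{1..<n}. D' k = D k" for D'
    unfolding C_def using that by (intro rhs_matrix_cong) blast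
  have invA: "invertible (matrix_abs X)" using assms(1) by (rule invertible_matrix_abs)
  have invK: "invertible (kronecker_sum (matrix_abs X))"
    using assms(1) by (rule invertible_kronecker_sum_matrix_abs)
  have solve: "Z ** matrix_abs X + matrix_abs X ** Z = C \<longleftrightarrow>
      mvec Z = matrix_inv (kronecker_sum (matrix_abs X)) *v mvec C" for Z
  proof -
    let ?K = "kronecker_sum (matrix_abs X)"
    have "Z ** matrix_abs X + matrix_abs X ** Z = C \<longleftrightarrow> ?K *v mvec Z = mvec C"
      by (simp only: kronecker_sum_mvec mvec_eq_iff)
    also have "\<dots> \<longleftrightarrow> mvec Z = matrix_inv ?K *v mvec C"
    proof
      assume "?K *v mvec Z = mvec C"
      then have "matrix_inv ?K *v (?K *v mvec Z) = matrix_inv ?K *v mvec C" by simp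
      then show "mvec Z = matrix_inv ?K *v mvec C"
        by (simp only: matrix_vector_mul_assoc matrix_inv_left [OF invK] matrix_vector_mul_lid)
    next
      assume "mvec Z = matrix_inv ?K *v mvec C"
      then show "?K *v mvec Z = mvec C"
        by (simp only: matrix_vector_mul_assoc matrix_inv_right [OF invK] matrix_vector_mul_lid)
    qed
    finally show ?thesis .
  qed
  have "ndiff n (\<lambda>Y. mvec (matrix_abs Y)) dX X = mvec (D n)"
    unfolding D_def by (rule ndiff_bounded_linear [OF bounded_linear_mvec S smooth])
  then have vec: "ndiff n (\<lambda>Y. mvec (matrix_abs Y)) dX X =
      matrix_inv (kronecker_sum (matrix_abs X)) *v mvec C"
    using eq solve by simp
  \<comment> \<open>Differentials of a Hermitian-valued function are Hermitian, so
    \<open>trace (D n)\<close> is real and the \<open>Re\<close> in \<open>trace_norm\<close> loses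
    nothing.\<close>
  have "cadjoint (D n) = ndiff n (\<lambda>Y. cadjoint (matrix_abs Y)) dX X"
    unfolding D_def by (rule ndiff_bounded_linear [OF bounded_linear_cadjoint S smooth, symmetric])
  also have "\<dots> = D n"
    unfolding D_def by (rule ndiff_cong_open [OF S]) (simp add: S_def cadjoint_matrix_abs)
  finally have herm: "cadjoint (D n) = D n" .
  have "Im (D n $ i $ i) = 0" for i
  proof -
    have "cnj (D n $ i $ i) = D n $ i $ i" by (metis herm cadjoint_nth)
    then show ?thesis by (simp add: complex_eq_iff)
  qed
  then have real: "complex_of_real (Re (trace (D n))) = trace (D n)"
    by (simp add: complex_eq_iff trace_def)
  have "ndiff n trace_norm dX X = Re (trace (D n))"
    unfolding tn D_def by (rule ndiff_bounded_linear [OF Re_trace S smooth])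
  moreover have "trace (matrix_inv (matrix_abs X) ** C) = 2 * trace (D n)"
    unfolding eq [symmetric] using invA by (rule trace_mul_inverse_commute)
  ultimately have trace: "complex_of_real (ndiff n trace_norm dX X) =
      1 / 2 * trace (matrix_inv (matrix_abs X) ** C)"
    by (simp only: real) simp
  show ?thesis
  proof (intro conjI)
    show "\<forall>k. ndiff k (matrix_abs :: complex^'m^'m \<Rightarrow> complex^'m^'m) dX differentiable (at X)"
      by (intro allI smooth S(2))
    show "\<forall>k. ndiff k (trace_norm :: complex^'m^'m \<Rightarrow> real) dX differentiable (at X)"
      by (intro allI tn_smooth)
    show "\<forall>D'. (\<forall>k\<in>{1..<n}. D' k = D k) \<longrightarrow> rhs_matrix n D' = C"
      by (intro allI impI lower)
    show "\<forall>Z. Z ** matrix_abs X + matrix_abs X ** Z = C \<longleftrightarrow>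
           mvec Z = matrix_inv (kronecker_sum (matrix_abs X)) *v mvec C"
      by (intro allI solve)
  qed (rule square zero leibniz eq invA invK vec trace)+
qed

end
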